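(* Let $m\ge 2$ be an integer, let $\gamma=1\,m\,(m-1)\cdots 2\in\mathcal S_m$ (that is, $1$ followed by $m,m-1,\dots,2$), and let $B=B(t,x)=\sum_{n\ge 0}t^n\sum_{\sigma\in\mathcal S_n(123)}x^{\gamma\text{-mch}(\sigma)}$. Then $$B=\frac{1+(x-1)t^mB^m}{1-tB},$$ and for all integers $n\ge 0$, $k\ge 1$ the coefficient of $t^nx^k$ in $B$ is $$[t^nx^k]B=\frac{1}{k} \sum_{i=k}^{\lfloor n/m\rfloor} (-1)^{i-k} \binom{2n-mi}{n-mi,\;n+1-i,\;k-1,\;i-k}.$$
   Context: $\mathcal S_n$ is the set of permutations of $\{1,\dots,n\}$ in one-line notation ($\mathcal S_0$ contains only the empty permutation, on which all statistics are $0$). For a word $w$ of distinct integers, $\mathrm{red}(w)$ replaces the $i$-th smallest letter by $i$. $\sigma\in\mathcal S_n$ avoids $\lambda\in\mathcal S_k$ (classical avoidance) if no (not necessarily contiguous) subsequence $\sigma_{i_1}\cdots\sigma_{i_k}$, $i_1<\dots<i_k$, has reduction $\lambda$; $\mathcal S_n(\lambda)$ is the set of such $\sigma$. $\gamma\text{-mch}(\sigma)$ is the number of $i$ with $\mathrm{red}(\sigma_i\sigma_{i+1}\cdots\sigma_{i+k-1})=\gamma$ for $\gamma\in\mathcal S_k$. The multinomial coefficient is $\binom{a}{b_1,b_2,b_3,b_4}=\frac{a!}{b_1!b_2!b_3!b_4!}$ with $b_1+b_2+b_3+b_4=a$. Identities are of formal power series in $t$ over $\mathbb Q[x]$. *)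

theory Defs
  imports
    "HOL-Computational_Algebra.Computational_Algebra"
    "HOL-Combinatorics.Multiset_Permutations"
    "HOL-Library.Sublist"
begin

text \<open>
  Permutations of \<open>{1..n}\<close> are lists in one-line notation, i.e. the elements of
  \<^term>\<open>permutations_of_set {1..n}\<close>.
\<close>

text \<open>The rank of \<open>a\<close> among the letters of \<open>w\<close>; meant for words with distinct letters.\<close>

definition red :: "nat list \<Rightarrow> nat list" where
  "red w = map (\<lambda>a. card {b \<in> set w. b \<le> a}) w"

definition avoids :: "nat list \<Rightarrow> nat list \<Rightarrow> bool" where
  "avoids \<sigma> \<pi> \<longleftrightarrow> \<not> (\<exists>\<tau>. subseq \<tau> \<sigma> \<and> red \<tau> = \<pi>)"

definition avoiders :: "nat \<Rightarrow> nat list \<Rightarrow> nat list set" where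
  "avoiders n \<pi> = {\<sigma> \<in> permutations_of_set {1..n}. avoids \<sigma> \<pi>}"

text \<open>
  Positions are counted from 0. For nonempty \<open>\<gamma>\<close> the empty permutation has no match.
\<close>

definition mch :: "nat list \<Rightarrow> nat list \<Rightarrow> nat" where
  "mch \<gamma> \<sigma> = card {i. i + length \<gamma> \<le> length \<sigma> \<and> red (take (length \<gamma>) (drop i \<sigma>)) = \<gamma>}"

text \<open>The word \<open>1 m (m-1) \<dots> 2\<close>.\<close>

definition gamma_pat :: "nat \<Rightarrow> nat list" where
  "gamma_pat m = 1 # rev [2..<Suc m]"

text \<open>
  Power series in \<open>t\<close> (the variable \<^const>\<open>fps_X\<close>) with coefficients in \<open>\<rat>[x]\<close>,
  where \<open>x\<close> is \<^term>\<open>[:0, 1:] :: rat poly\<close>.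
\<close>

definition match_gf :: "nat list \<Rightarrow> nat list \<Rightarrow> rat poly fps" where
  "match_gf \<pi> \<gamma> = Abs_fps (\<lambda>n. \<Sum>\<sigma>\<in>avoiders n \<pi>. [:0, 1:] ^ mch \<gamma> \<sigma>)"

text \<open>The usual multinomial coefficient when \<open>a = sum_list bs\<close>.\<close>

definition multinom :: "nat \<Rightarrow> nat list \<Rightarrow> rat" where
  "multinom a bs = fact a / (\<Prod>b\<leftarrow>bs. fact b)"

text \<open>
  Since \<open>\<rat>[x]\<close> is not a field, there is no division operator on \<^typ>\<open>rat poly fps\<close>.
  For a series \<open>g\<close> with constant coefficient 1, the series \<open>1/g\<close> is
  \<^term>\<open>fps_right_inverse g 1\<close>, as the following instance confirms.
\<close>

lemma fps_right_inverse_one_minus_X_mult: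
  fixes F :: "rat poly fps"
  shows "(1 - fps_X * F) * fps_right_inverse (1 - fps_X * F) 1 = 1"
  by (rule fps_right_inverse) simp

end

theory Submission
  imports Defs
begin

text \<open>
  In a 123-avoiding permutation a match of \<open>1 m (m-1) \<dots> 2\<close> is a left-to-right minimum followed by
  at least \<open>m - 1\<close> letters that are not left-to-right minima. Read such a permutation from the left
  while recording the number \<open>h\<close> of letters above the current minimum that are still to come (they
  have to come in decreasing order) and the number \<open>r\<close> of letters below it. The completions are then
  counted by Lukasiewicz-type steps \<open>h \<rightarrow> h + 1 - k\<close>, \<open>r \<rightarrow> r - 1\<close> of weight
  \<open>w\<^sub>k = x\<close> if \<open>k \<ge> m\<close> and \<open>1\<close> otherwise. With \<open>W(u) = \<Sum> w\<^sub>k u\<^sup>k = (1 + (x-1) u\<^sup>m) / (1 - u)\<close> and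
  \<open>\<Lambda>(u) = \<Sum> \<Lambda>\<^sub>h(t) u\<^sup>h\<close>, where \<open>\<Lambda>\<^sub>h\<close> counts the walks from \<open>h\<close>, the recurrence reads
  \<open>(u - t W(u)) \<Lambda>(u) = u - t \<Lambda>\<^sub>0\<close>. By the kernel method, substituting the solution \<open>u = A\<close> of
  \<open>A = t W(A)\<close> gives \<open>A = t \<Lambda>\<^sub>0 = t B\<close>, which is the functional equation, and Lagrange inversion
  gives the coefficients. The kernel method and the inversion are carried out over the field \<open>\<rat>\<close>
  after specialising \<open>x\<close> to an arbitrary rational number.
\<close>

section \<open>Avoidance and matches letter by letter\<close>

text \<open>The weak order lets the equivalence with avoidance hold for arbitrary words; strictness
  is recovered later from distinctness.\<close>

fun no123 :: "nat list \<Rightarrow> bool" where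
  "no123 [] = True"
| "no123 (c # w) = (no123 w \<and> sorted_wrt (\<ge>) (filter (\<lambda>x. c < x) w))"

lemma subseq_Cons_Cons_iff:
  "subseq (a # v) (c # w) \<longleftrightarrow> (a = c \<and> subseq v w) \<or> subseq (a # v) w"
  by (auto dest: subseq_Cons')

lemma sorted_wrt_iff_subseq:
  "sorted_wrt P w \<longleftrightarrow> (\<forall>a b. subseq [a, b] w \<longrightarrow> P a b)"
proof (induction w)
  case (Cons c w)
  have "(\<forall>a b. subseq [a, b] (c # w) \<longrightarrow> P a b) \<longleftrightarrow> (\<forall>b\<in>set w. P c b) \<and> (\<forall>a b. subseq [a, b] w \<longrightarrow> P a b)"
    unfolding subseq_Cons_Cons_iff[of _ _ c] subseq_singleton_left by blast
  then show ?case using Cons.IH by simp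
qed simp

lemma subseq_filter_iff: "subseq v (filter P w) \<longleftrightarrow> subseq v w \<and> (\<forall>x\<in>set v. P x)"
proof (induction w arbitrary: v)
  case (Cons c w)
  show ?case
  proof (cases v)
    case (Cons a u)
    then show ?thesis using Cons.IH by (auto simp: subseq_Cons_Cons_iff)
  qed simp
qed (metis empty_iff filter.simps(1) list.set(1) list_emb_Nil2)

text \<open>The rank is monotone in the letter, so strictly increasing ranks force strictly
  increasing letters.\<close>

lemma red_eq_123_iff: "red \<tau> = [1, 2, 3] \<longleftrightarrow> (\<exists>a b c. \<tau> = [a, b, c] \<and> a < b \<and> b < c)"
proof
  assume r: "red \<tau> = [1, 2, 3]"
  then have "length \<tau> = 3" by (metis length_map red_def length_Cons list.size(3) numeral_3_eq_3)
  then obtain a b c where t: "\<tau> = [a, b, c]"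
    by (auto simp: numeral_3_eq_3 length_Suc_conv)
  have mono: "card {z \<in> set \<tau>. z \<le> x} \<le> card {z \<in> set \<tau>. z \<le> y}" if "x \<le> y" for x y
    by (rule card_mono) (use that in auto)
  show "\<exists>a b c. \<tau> = [a, b, c] \<and> a < b \<and> b < c"
    using r mono[of b a] mono[of c b] unfolding t red_def by force
next
  assume "\<exists>a b c. \<tau> = [a, b, c] \<and> a < b \<and> b < c"
  then obtain a b c where t: "\<tau> = [a, b, c]" "a < b" "b < c" by auto
  have "{z \<in> set \<tau>. z \<le> a} = {a}" "{z \<in> set \<tau>. z \<le> b} = {a, b}" "{z \<in> set \<tau>. z \<le> c} = {a, b, c}"
    using t by auto
  then show "red \<tau> = [1, 2, 3]" using t by (simp add: red_def)
qed

text \<open>A 123 either lies in the tail or starts with the first letter \<open>d\<close>; the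
  latter means an increasing pair among the later letters above \<open>d\<close>, which the filter
  condition of \<open>no123\<close> excludes.\<close>

lemma avoids_123_iff: "avoids w [1, 2, 3] \<longleftrightarrow> no123 w"
proof -
  have "no123 w \<longleftrightarrow> (\<forall>a b c. subseq [a, b, c] w \<longrightarrow> \<not> (a < b \<and> b < c))"
  proof (induction w)
    case (Cons d w)
    have "(\<forall>a b c. subseq [a, b, c] (d # w) \<longrightarrow> \<not> (a < b \<and> b < c)) \<longleftrightarrow>
        (\<forall>a b c. subseq [a, b, c] w \<longrightarrow> \<not> (a < b \<and> b < c)) \<and>
        (\<forall>b c. subseq [b, c] w \<longrightarrow> \<not> (d < b \<and> b < c))"
      unfolding subseq_Cons_Cons_iff[of _ _ d] by blast
    moreover have "\<not> (d < b \<and> b < c) \<longleftrightarrow> (d < b \<and> d < c \<longrightarrow> c \<le> b)" for b c by auto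
    ultimately show ?case using Cons.IH by (simp add: sorted_wrt_iff_subseq subseq_filter_iff imp_conjL)
  qed simp
  then show ?thesis
    unfolding avoids_def red_eq_123_iff by blast
qed

section \<open>Matches of the pattern \<open>1 m (m-1) ... 2\<close>\<close>

lemma distinct_if_sorted_wrt_greater: "sorted_wrt (>) w \<Longrightarrow> distinct (w :: nat list)"
  by (induction w) auto

lemma length_gamma_pat: "m \<ge> 1 \<Longrightarrow> length (gamma_pat m) = m"
  by (auto simp: gamma_pat_def simp del: upt_Suc)

text \<open>Induction on \<open>\<rho>\<close>: a letter \<open>y\<close> added in front of
  \<open>\<rho>\<close> exceeds all others, so it takes the top rank and leaves the other ranks
  unchanged.\<close>

lemma red_gamma:
  assumes "sorted_wrt (>) \<rho>" "\<And>x. x \<in> set \<rho> \<Longrightarrow> a < x"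
  shows "red (a # \<rho>) = 1 # rev [2..<length \<rho> + 2]"
  using assms
proof (induction \<rho>)
  case Nil
  have "{b. b = a \<and> b \<le> a} = {a}" by auto
  then show ?case by (simp add: red_def)
next
  case (Cons y \<rho>)
  let ?S = "set (a # y # \<rho>)"
  have y: "z < y" if "z \<in> set (a # \<rho>)" for z using Cons.prems that by auto
  have low: "{b \<in> ?S. b \<le> z} = {b \<in> set (a # \<rho>). b \<le> z}" if "z \<in> set (a # \<rho>)" for z
    using y[OF that] by auto
  have "distinct (a # y # \<rho>)"
    using Cons.prems by (auto simp: distinct_if_sorted_wrt_greater)
  then have "card ?S = length \<rho> + 2" by (metis distinct_card length_Cons add_2_eq_Suc')
  moreover have "{b \<in> ?S. b \<le> y} = ?S" using y by (auto intro: less_imp_le)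
  ultimately have top: "card {b \<in> ?S. b \<le> y} = length \<rho> + 2" by metis
  have "red (a # y # \<rho>) = card {b \<in> ?S. b \<le> a} # card {b \<in> ?S. b \<le> y} # map (\<lambda>z. card {b \<in> ?S. b \<le> z}) \<rho>"
    unfolding red_def by (simp only: list.map)
  also have "\<dots> = card {b \<in> set (a # \<rho>). b \<le> a} # (length \<rho> + 2) # map (\<lambda>z. card {b \<in> set (a # \<rho>). b \<le> z}) \<rho>"
    unfolding top by (intro arg_cong2[of _ _ _ _ "(#)"] arg_cong[where f = card] map_cong refl low) simp_all
  also have "\<dots> = hd (red (a # \<rho>)) # (length \<rho> + 2) # tl (red (a # \<rho>))"
    unfolding red_def by (simp only: list.map list.sel)
  also have "\<dots> = 1 # rev [2..<length (y # \<rho>) + 2]" using Cons by simp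
  finally show ?case .
qed

text \<open>Turns a match into an order condition. Forward, monotonicity of the rank transfers
  strict inequalities from ranks to letters; backward, \<open>red_gamma\<close> computes the
  ranks.\<close>

lemma red_eq_gamma_iff:
  assumes "m \<ge> 1"
  shows "red \<tau> = gamma_pat m \<longleftrightarrow>
    (\<exists>a \<rho>. \<tau> = a # \<rho> \<and> length \<rho> = m - 1 \<and> sorted_wrt (>) \<rho> \<and> (\<forall>x\<in>set \<rho>. a < x))"
proof
  assume r: "red \<tau> = gamma_pat m"
  then have "length \<tau> = length (gamma_pat m)" by (metis length_map red_def)
  then have len: "length \<tau> = m" using assms by (simp add: length_gamma_pat)
  then obtain a \<rho> where t: "\<tau> = a # \<rho>" using assms by (cases \<tau>) auto
  let ?r = "\<lambda>x. card {z \<in> set \<tau>. z \<le> x}"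
  have mono: "?r x \<le> ?r y" if "x \<le> y" for x y
    by (rule card_mono) (use that in auto)
  have ra: "?r a = 1" and rr: "map ?r \<rho> = rev [2..<Suc m]"
    using r unfolding t red_def gamma_pat_def by simp_all
  have less: "x < y" if "?r x < ?r y" for x y
    using mono[of y x] that by (meson leD not_le_imp_less)
  have "sorted_wrt (>) (map ?r \<rho>)" unfolding rr by (simp add: sorted_wrt_rev del: upt_Suc)
  then have "sorted_wrt (\<lambda>x y. ?r y < ?r x) \<rho>" by (simp only: sorted_wrt_map)
  then have "sorted_wrt (>) \<rho>" by (rule sorted_wrt_mono_rel[rotated]) (rule less)
  moreover have "a < x" if "x \<in> set \<rho>" for x
  proof -
    have "?r x \<in> set (rev [2..<Suc m])" using that unfolding rr[symmetric] by auto
    then have "?r a < ?r x" unfolding ra by auto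
    then show ?thesis by (rule less)
  qed
  ultimately show "\<exists>a \<rho>. \<tau> = a # \<rho> \<and> length \<rho> = m - 1 \<and> sorted_wrt (>) \<rho> \<and> (\<forall>x\<in>set \<rho>. a < x)"
    using len t by auto
next
  assume "\<exists>a \<rho>. \<tau> = a # \<rho> \<and> length \<rho> = m - 1 \<and> sorted_wrt (>) \<rho> \<and> (\<forall>x\<in>set \<rho>. a < x)"
  then obtain a \<rho> where t: "\<tau> = a # \<rho>" "length \<rho> + 2 = Suc m" "sorted_wrt (>) \<rho>" "\<And>x. x \<in> set \<rho> \<Longrightarrow> a < x"
    using assms by auto
  show "red \<tau> = gamma_pat m" using red_gamma[OF t(3,4)] unfolding t(1,2) gamma_pat_def .
qed

lemma mch_Cons:
  assumes "\<gamma> \<noteq> []"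
  shows "mch \<gamma> (c # w) = mch \<gamma> w + of_bool (red (take (length \<gamma>) (c # w)) = \<gamma>)"
proof -
  let ?I = "{i. i + length \<gamma> \<le> length w \<and> red (take (length \<gamma>) (drop i w)) = \<gamma>}"
  \<comment> \<open>Equality with \<open>\<gamma>\<close> forces the window to have full length,
    which supplies the length test at position 0.\<close>
  have r: "length \<gamma> \<le> length v" if "red (take (length \<gamma>) v) = \<gamma>" for v
  proof -
    have "length (take (length \<gamma>) v) = length \<gamma>" using that by (metis length_map red_def)
    then show ?thesis by simp
  qed
  have "{i. i + length \<gamma> \<le> length (c # w) \<and> red (take (length \<gamma>) (drop i (c # w))) = \<gamma>}
    = Suc ` ?I \<union> (if red (take (length \<gamma>) (c # w)) = \<gamma> then {0} else {})" (is "?L = ?R")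
  proof (rule set_eqI)
    fix i show "i \<in> ?L \<longleftrightarrow> i \<in> ?R" using r[of "c # w"] by (cases i) auto
  qed
  moreover have "finite ?I" by (rule finite_subset[of _ "{..length w}"]) auto
  ultimately show ?thesis
    unfolding mch_def by (auto simp: card_image)
qed

section \<open>Completions of a 123-avoiding prefix\<close>

text \<open>
  \<open>words ds r\<close> consists of the possible continuations after the letter \<open>r + 1\<close> has appeared as
  the current minimum and \<open>ds\<close> lists the larger letters that are still to come. In \<open>words0 ds r\<close>
  the continuation has to start with a new left-to-right minimum.
\<close>

definition stack :: "nat list \<Rightarrow> nat \<Rightarrow> bool" where
  "stack ds r \<longleftrightarrow> sorted_wrt (>) ds \<and> (\<forall>x\<in>set ds. r < x)"

definition words :: "nat list \<Rightarrow> nat \<Rightarrow> nat list set" where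
  "words ds r = {w. distinct w \<and> set w = set ds \<union> {1..r} \<and> no123 w \<and> filter (\<lambda>x. r < x) w = ds}"

definition words0 :: "nat list \<Rightarrow> nat \<Rightarrow> nat list set" where
  "words0 ds r = {w \<in> words ds r. w = [] \<or> hd w \<le> r}"

section \<open>Decomposition of completions by their first letter\<close>

lemma sorted_wrt_greater_unique:
  fixes v w :: "nat list"
  assumes "sorted_wrt (>) v" "sorted_wrt (>) w" "set v = set w"
  shows "v = w"
proof -
  have "rev v = rev w"
    by (rule strict_sorted_equal) (use assms in \<open>simp_all add: sorted_wrt_rev\<close>)
  then show ?thesis by simp
qed

lemma finite_words: "finite (words ds r)"
  by (rule finite_subset[OF _ finite_permutations_of_set[of "set ds \<union> {1..r}"]])
    (auto simp: words_def permutations_of_set_def)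

lemma finite_words0: "finite (words0 ds r)"
  unfolding words0_def using finite_words by simp

lemma words_Nil: "words [] r = words0 [] r"
proof -
  have "w = [] \<or> hd w \<le> r" if "w \<in> words [] r" for w
    using that by (cases w) (auto simp: words_def split: if_splits)
  then show ?thesis by (auto simp: words0_def)
qed

text \<open>\<open>d\<close> is the largest letter still to come, so it cannot start a 123 and
  placing it first does not constrain the rest.\<close>

lemma Cons_in_words_iff:
  assumes "stack (d # ds) r"
  shows "d # w \<in> words (d # ds) r \<longleftrightarrow> w \<in> words ds r"
proof
  assume a: "d # w \<in> words (d # ds) r"
  have "d \<notin> set ds" "d \<notin> {1..r}" using assms by (auto simp: stack_def)
  moreover have "d \<notin> set w" "insert d (set w) = insert d (set ds \<union> {1..r})"
    using a by (auto simp: words_def)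
  ultimately have "set w = set ds \<union> {1..r}" by (metis Un_iff insert_ident)
  then show "w \<in> words ds r" using a assms by (simp add: words_def stack_def)
next
  assume a: "w \<in> words ds r"
  then have less: "x < d" if "x \<in> set w" for x
  proof -
    have "x \<in> set ds \<union> {1..r}" using that a by (simp add: words_def)
    then show ?thesis using assms by (auto simp: stack_def)
  qed
  then have "filter (\<lambda>x. d < x) w = []" by (auto simp: filter_empty_conv dest: less_asym)
  moreover have "d \<notin> set w" using less by blast
  ultimately show "d # w \<in> words (d # ds) r" using a assms by (simp add: words_def stack_def)
qed

text \<open>The letters above the minimum come in the order of the stack, so a first letter above
  \<open>r\<close> must be its top \<open>d\<close>.\<close>

lemma words_Cons:
  assumes "stack (d # ds) r"
  shows "words (d # ds) r = words0 (d # ds) r \<union> (#) d ` words ds r"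
    and "words0 (d # ds) r \<inter> (#) d ` words ds r = {}"
proof -
  show "words0 (d # ds) r \<inter> (#) d ` words ds r = {}"
    using assms by (auto simp: words0_def stack_def)
  have "w \<in> words0 (d # ds) r \<union> (#) d ` words ds r" if w: "w \<in> words (d # ds) r" for w
  proof (cases "w = [] \<or> hd w \<le> r")
    case True
    then show ?thesis using w by (auto simp: words0_def)
  next
    case False
    then obtain c v where cv: "w = c # v" "r < c" by (cases w) auto
    then have "c = d" using w by (simp add: words_def)
    then show ?thesis using w cv(1) Cons_in_words_iff[OF assms] by blast
  qed
  then show "words (d # ds) r = words0 (d # ds) r \<union> (#) d ` words ds r"
    using Cons_in_words_iff[OF assms] by (auto simp: words0_def)
qed

lemma words0_0: "words0 ds 0 = (if ds = [] then {[]} else {})"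
proof -
  have "w = []" if "w \<in> words0 ds 0" for w
  proof (cases w)
    case (Cons c v)
    then have "c = 0" using that by (simp add: words0_def)
    moreover have "set (filter (\<lambda>x. 0 < x) w) = set w" using that by (auto simp: words0_def words_def)
    then have "\<forall>x\<in>set w. 0 < x" unfolding set_filter by blast
    ultimately show ?thesis using Cons by simp
  qed
  moreover have "[] \<in> words0 ds 0 \<longleftrightarrow> ds = []" by (auto simp: words0_def words_def)
  ultimately show ?thesis by auto
qed

text \<open>The letters above the new minimum \<open>Suc r\<close> are those of \<open>ds\<close>,
  whose order is already prescribed as decreasing, so no new constraint arises.\<close>

lemma Suc_Cons_in_words_iff:
  assumes "stack ds (Suc r)"
  shows "Suc r # w \<in> words ds (Suc r) \<longleftrightarrow> w \<in> words ds r"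
proof -
  have dec: "sorted_wrt (\<ge>) ds"
    using assms unfolding stack_def by (auto elim: sorted_wrt_mono_rel[rotated])
  have f: "filter (\<lambda>x. Suc r < x) w = filter (\<lambda>x. r < x) w" if "Suc r \<notin> set w"
    by (rule filter_cong) (use that in \<open>auto simp: less_Suc_eq intro: Suc_lessI\<close>)
  have n: "Suc r \<notin> set ds \<union> {1..r}" using assms by (auto simp: stack_def)
  show ?thesis
  proof
    assume a: "Suc r # w \<in> words ds (Suc r)"
    then have "Suc r \<notin> set w" by (simp add: words_def)
    moreover have "insert (Suc r) (set w) = insert (Suc r) (set ds \<union> {1..r})"
      using a by (auto simp: words_def atLeastAtMostSuc_conv)
    ultimately have "set w = set ds \<union> {1..r}" using n by (metis insert_ident)
    then show "w \<in> words ds r" using a f by (simp add: words_def)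
  next
    assume a: "w \<in> words ds r"
    then have "Suc r \<notin> set w" using n by (simp add: words_def)
    then show "Suc r # w \<in> words ds (Suc r)"
      using a f dec by (auto simp: words_def atLeastAtMostSuc_conv)
  qed
qed

text \<open>If a smaller \<open>c\<close> comes first, \<open>Suc r\<close> lies above the minimum,
  and avoiding 123 forces it to come after all of \<open>ds\<close>: it joins the bottom of the
  stack.\<close>

lemma Cons_in_words_Suc_iff:
  assumes st: "stack ds (Suc r)" and "c \<le> r"
  shows "c # w \<in> words ds (Suc r) \<longleftrightarrow> c # w \<in> words (ds @ [Suc r]) r"
proof -
  have set_eq: "set (ds @ [Suc r]) \<union> {1..r} = set ds \<union> {1..Suc r}" by auto
  have "filter (\<lambda>x. r < x) (c # w) = ds @ [Suc r]" if a: "c # w \<in> words ds (Suc r)"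
  proof (rule sorted_wrt_greater_unique)
    let ?F = "filter (\<lambda>x. r < x) (c # w)"
    have F: "?F = filter (\<lambda>x. r < x) (filter (\<lambda>x. c < x) w)"
      using \<open>c \<le> r\<close> by (auto simp: intro!: filter_cong)
    have "sorted_wrt (\<ge>) ?F" unfolding F
      by (rule sorted_wrt_filter) (use a in \<open>simp add: words_def\<close>)
    moreover have "distinct ?F" using a by (auto simp: words_def)
    ultimately show "sorted_wrt (>) ?F"
      by (metis (no_types, lifting) distinct_conv_nth le_neq_implies_less order_less_imp_not_eq2 sorted_wrt_iff_nth_less order_less_trans)
    show "sorted_wrt (>) (ds @ [Suc r])" using st by (auto simp: stack_def sorted_wrt_append)
    have "set (c # w) = set ds \<union> {1..Suc r}" using a unfolding words_def by blast
    then have "set ?F = {x \<in> set ds \<union> {1..Suc r}. r < x}" by (simp only: set_filter)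
    then show "set ?F = set (ds @ [Suc r])" using st by (auto simp: stack_def)
  qed
  moreover have "filter (\<lambda>x. Suc r < x) (c # w) = ds" if "filter (\<lambda>x. r < x) (c # w) = ds @ [Suc r]"
  proof -
    have "filter (\<lambda>x. Suc r < x) (c # w) = filter (\<lambda>x. Suc r < x) (filter (\<lambda>x. r < x) (c # w))"
      unfolding filter_filter by (rule filter_cong) auto
    also have "\<dots> = ds" unfolding that using st by (simp add: stack_def filter_id_conv)
    finally show ?thesis .
  qed
  ultimately show ?thesis unfolding words_def mem_Collect_eq set_eq by blast
qed

text \<open>The basic recurrence: the value \<open>Suc r\<close> is either the next minimum or
  passed over and stacked.\<close>

lemma words0_Suc:
  assumes "stack ds (Suc r)"
  shows "words0 ds (Suc r) = (#) (Suc r) ` words ds r \<union> words0 (ds @ [Suc r]) r"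
    and "(#) (Suc r) ` words ds r \<inter> words0 (ds @ [Suc r]) r = {}"
proof -
  show "(#) (Suc r) ` words ds r \<inter> words0 (ds @ [Suc r]) r = {}"
    by (auto simp: words0_def)
  have "w \<in> words0 ds (Suc r) \<longleftrightarrow> w \<in> (#) (Suc r) ` words ds r \<union> words0 (ds @ [Suc r]) r" for w
  proof (cases w)
    case Nil
    have "[] \<notin> words ds (Suc r)" "[] \<notin> words (ds @ [Suc r]) r"
      by (auto simp: words_def)
    then show ?thesis using Nil by (auto simp: words0_def)
  next
    case (Cons c v)
    consider "c = Suc r" | "c \<le> r" | "Suc r < c" by linarith
    then show ?thesis
    proof cases
      case 1
      then show ?thesis using Cons Suc_Cons_in_words_iff[OF assms] by (auto simp: words0_def)
    next
      case 2
      then have "c \<le> Suc r" "c \<noteq> Suc r" by simp_all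
      then show ?thesis
        using 2 unfolding Cons words0_def by (simp add: image_iff Cons_in_words_Suc_iff[OF assms 2])
    next
      case 3
      then have "\<not> c \<le> Suc r" "\<not> c \<le> r" "c \<noteq> Suc r" by simp_all
      then show ?thesis unfolding Cons words0_def by (simp add: image_iff)
    qed
  qed
  then show "words0 ds (Suc r) = (#) (Suc r) ` words ds r \<union> words0 (ds @ [Suc r]) r" by blast
qed

text \<open>Before the first letter, a virtual minimum \<open>n + 1\<close> with an empty stack
  serves as starting state.\<close>

lemma avoiders_eq_words0: "avoiders n [1, 2, 3] = words0 [] n"
proof -
  have "filter (\<lambda>x. n < x) w = []" if "set w = {1..n}" for w :: "nat list"
    using that by (auto simp: filter_empty_conv)
  moreover have "hd w \<le> n" if "set w = {1..n}" "w \<noteq> []" for w :: "nat list"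
    using that hd_in_set[of w] by auto
  ultimately show ?thesis
    unfolding avoiders_def words0_def words_def permutations_of_set_def avoids_123_iff by auto
qed

section \<open>Change of the number of matches when a letter is prepended\<close>

lemma gamma_pat_neq_Nil: "gamma_pat m \<noteq> []"
  by (simp add: gamma_pat_def)

text \<open>For \<open>m >= 2\<close> a match needs a larger letter directly after its first
  one.\<close>

lemma mch_gamma_Cons_max:
  assumes "m \<ge> 2" "\<And>x. x \<in> set w \<Longrightarrow> x < d"
  shows "mch (gamma_pat m) (d # w) = mch (gamma_pat m) w"
proof -
  have "red (take m (d # w)) \<noteq> gamma_pat m"
  proof
    assume "red (take m (d # w)) = gamma_pat m"
    moreover have m: "m = Suc (Suc (m - 2))" using assms(1) by simp
    ultimately have "length (take (Suc (m - 2)) w) = m - 1" "\<forall>x\<in>set (take (Suc (m - 2)) w). d < x"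
      using red_eq_gamma_iff[of m "take m (d # w)"] assms(1) by (metis One_nat_def le_add1 list.inject plus_1_eq_Suc take_Suc_Cons)+
    then show False using assms m by (cases w) (auto dest: less_asym)
  qed
  then show ?thesis using assms(1) by (simp add: mch_Cons length_gamma_pat gamma_pat_neq_Nil del: take_Suc_Cons)
qed

text \<open>The letters above \<open>r\<close> directly after the new minimum come from
  \<open>ds\<close> and so decrease automatically; a match starts at the minimum exactly when this
  run has at least \<open>m - 1\<close> letters.\<close>

lemma mch_gamma_Cons_min:
  assumes "m \<ge> 2" "stack ds (Suc r)" "w \<in> words ds r"
  shows "mch (gamma_pat m) (Suc r # w) =
    mch (gamma_pat m) w + of_bool (m \<le> Suc (length (takeWhile (\<lambda>x. r < x) w)))"
proof -
  let ?P = "\<lambda>x. r < x"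
  have "Suc r \<notin> set w" using assms(2,3) by (auto simp: words_def stack_def)
  then have P: "?P x \<longleftrightarrow> Suc r < x" if "x \<in> set w" for x
    using that by (metis Suc_lessD Suc_lessI)
  \<comment> \<open>The run is a prefix of \<open>ds\<close>, hence decreasing.\<close>
  have "ds = filter ?P (takeWhile ?P w @ dropWhile ?P w)" using assms(3) by (simp add: words_def)
  then have "ds = takeWhile ?P w @ filter ?P (dropWhile ?P w)"
    by (simp only: filter_append) (metis filter_True set_takeWhileD)
  then have dec: "sorted_wrt (>) (takeWhile ?P w)"
    using assms(2) by (metis stack_def sorted_wrt_append)
  obtain k where k: "m = Suc k" using assms(1) by (cases m) auto
  have "red (take m (Suc r # w)) = gamma_pat m \<longleftrightarrow> k \<le> length (takeWhile ?P w)"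
  proof
    assume "red (take m (Suc r # w)) = gamma_pat m"
    then have l: "length (take k w) = k" and gr: "\<forall>x\<in>set (take k w). Suc r < x"
      using red_eq_gamma_iff[of m "take m (Suc r # w)"] k by auto
    have "takeWhile ?P w = takeWhile ?P (take k w @ drop k w)" by simp
    also have "\<dots> = take k w @ takeWhile ?P (drop k w)"
      by (rule takeWhile_append2) (use gr in auto)
    finally show "k \<le> length (takeWhile ?P w)" using l by simp
  next
    assume kl: "k \<le> length (takeWhile ?P w)"
    then have t: "take k w = take k (takeWhile ?P w)"
      by (metis append_eq_append_conv_if takeWhile_dropWhile_id take_append diff_is_0_eq take_0 append_Nil2)
    have "length (take k w) = k" using kl length_takeWhile_le[of ?P w] by simp
    moreover have "sorted_wrt (>) (take k w)" unfolding t using dec by (rule sorted_wrt_take)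
    moreover have "\<forall>x\<in>set (take k w). Suc r < x"
      using P unfolding t by (metis in_set_takeD set_takeWhileD)
    ultimately show "red (take m (Suc r # w)) = gamma_pat m"
      using red_eq_gamma_iff[of m "take m (Suc r # w)"] k by auto
  qed
  moreover have "length (gamma_pat m) = m"
    using assms(1) by (simp add: length_gamma_pat)
  ultimately show ?thesis by (simp add: mch_Cons gamma_pat_neq_Nil k)
qed

text \<open>
  Weight of the walks from height \<open>h\<close> to height \<open>0\<close> in \<open>r\<close> steps. A step with \<open>k = 0\<close> passes over
  a value that is not the next minimum; a step with \<open>k > 0\<close> makes it the next minimum, followed by
  exactly \<open>k - 1\<close> letters before the minimum after that.
\<close>

primrec run_weight :: "nat \<Rightarrow> 'a::comm_semiring_1 \<Rightarrow> nat \<Rightarrow> nat \<Rightarrow> 'a" where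
  "run_weight m x 0 = (\<lambda>h. of_bool (h = 0))"
| "run_weight m x (Suc r) = (\<lambda>h. \<Sum>k\<le>Suc h. (if m \<le> k then x else 1) * run_weight m x r (Suc h - k))"

text \<open>\<open>j\<close> counts the letters placed since the last minimum, and the
  \<open>of_bool\<close> exponent is the pending match at that minimum, decided when the run ends.
  Generalising over \<open>j\<close> lets the induction on the stack go through; \<open>k\<close>
  counts the letters still popped before the next minimum. \<open>E\<close> is supplied by the
  induction hypothesis of \<open>sum_words0\<close>.\<close>

lemma sum_words:
  fixes x :: "'a::comm_semiring_1"
  assumes m: "m \<ge> 2" and st: "stack ds r"
    and E: "\<And>es. stack es r \<Longrightarrow> (\<Sum>w\<in>words0 es r. x ^ mch (gamma_pat m) w) = run_weight m x r (length es)"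
  shows "(\<Sum>w\<in>words ds r. x ^ (mch (gamma_pat m) w + of_bool (m \<le> Suc (j + length (takeWhile (\<lambda>x. r < x) w)))))
    = (\<Sum>k\<le>length ds. (if m \<le> Suc (j + k) then x else 1) * run_weight m x r (length ds - k))"
  using st
proof (induction ds arbitrary: j)
  case Nil
  have "takeWhile (\<lambda>x. r < x) w = []" if "w \<in> words0 [] r" for w
    using that by (cases w) (auto simp: words0_def)
  then show ?case using E[OF Nil] by (simp add: words_Nil flip: sum_distrib_left)
next
  case (Cons d ds)
  let ?M = "\<lambda>j w. x ^ (mch (gamma_pat m) w + of_bool (m \<le> Suc (j + length (takeWhile (\<lambda>x. r < x) w))))"
  have st: "stack ds r" "r < d" using Cons.prems by (auto simp: stack_def)
  have tw: "takeWhile (\<lambda>x. r < x) w = []" if "w \<in> words0 (d # ds) r" for w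
    using that by (cases w) (auto simp: words0_def)
  have less: "z < d" if "w \<in> words ds r" "z \<in> set w" for w z
  proof -
    have "z \<in> set ds \<union> {1..r}" using that by (simp add: words_def)
    then show ?thesis using Cons.prems by (auto simp: stack_def)
  qed
  have "sum (?M j) (words (d # ds) r) = sum (?M j) (words0 (d # ds) r) + sum (?M j) ((#) d ` words ds r)"
    unfolding words_Cons(1)[OF Cons.prems]
    by (rule sum.union_disjoint) (use words_Cons(2)[OF Cons.prems] finite_words0 finite_words in auto)
  also have "sum (?M j) (words0 (d # ds) r) = (if m \<le> Suc j then x else 1) * run_weight m x r (length (d # ds))"
    using E[OF Cons.prems] by (simp add: tw mult.commute flip: sum_distrib_left)
  also have "sum (?M j) ((#) d ` words ds r) = sum (?M (Suc j)) (words ds r)"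
    using st(2) by (subst sum.reindex) (auto simp: mch_gamma_Cons_max[OF m less] intro!: sum.cong)
  also have "\<dots> = (\<Sum>k\<le>length ds. (if m \<le> Suc (Suc j + k) then x else 1) * run_weight m x r (length ds - k))"
    by (rule Cons.IH) (rule st)
  finally show ?case by (simp add: sum.atMost_Suc_shift del: sum.atMost_Suc)
qed

lemma sum_words0:
  fixes x :: "'a::comm_semiring_1"
  assumes m: "m \<ge> 2"
  shows "stack ds r \<Longrightarrow> (\<Sum>w\<in>words0 ds r. x ^ mch (gamma_pat m) w) = run_weight m x r (length ds)"
proof (induction r arbitrary: ds)
  case 0
  then show ?case by (simp add: words0_0 mch_def gamma_pat_def)
next
  case (Suc r)
  let ?f = "\<lambda>w. x ^ mch (gamma_pat m) w"
  have st: "stack ds r" "stack (ds @ [Suc r]) r"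
    using Suc.prems by (auto simp: stack_def sorted_wrt_append intro: Suc_lessD)
  have "sum ?f (words0 ds (Suc r)) = sum ?f ((#) (Suc r) ` words ds r) + sum ?f (words0 (ds @ [Suc r]) r)"
    unfolding words0_Suc(1)[OF Suc.prems]
    by (rule sum.union_disjoint) (use words0_Suc(2)[OF Suc.prems] finite_words0 finite_words in auto)
  also have "sum ?f ((#) (Suc r) ` words ds r) = 
      (\<Sum>w\<in>words ds r. x ^ (mch (gamma_pat m) w + of_bool (m \<le> Suc (0 + length (takeWhile (\<lambda>x. r < x) w)))))"
    by (subst sum.reindex) (auto simp: mch_gamma_Cons_min[OF m Suc.prems] intro!: sum.cong)
  also have "\<dots> = (\<Sum>k\<le>length ds. (if m \<le> Suc (0 + k) then x else 1) * run_weight m x r (length ds - k))"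
    by (rule sum_words[OF m st(1) Suc.IH])
  also have "sum ?f (words0 (ds @ [Suc r]) r) = run_weight m x r (Suc (length ds))"
    using Suc.IH[OF st(2)] by simp
  \<comment> \<open>Passing over \<open>Suc r\<close> is the summand \<open>k = 0\<close>, of weight
    1 since \<open>m >= 2\<close>; a new minimum followed by \<open>k\<close> letters is the summand
    \<open>k + 1\<close>.\<close>
  finally show ?case
    using m by (simp add: sum.atMost_Suc_shift add.commute del: sum.atMost_Suc)
qed

lemma match_gf_nth:
  assumes "m \<ge> 2"
  shows "match_gf [1, 2, 3] (gamma_pat m) $ n = run_weight m [:0, 1:] n 0"
  using sum_words0[OF assms, of "[]" n "[:0, 1:]"]
  by (simp add: match_gf_def avoiders_eq_words0[unfolded One_nat_def] stack_def)

section \<open>Kernel method and Lagrange inversion\<close>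

lemma fps_nth_power_mult_eq_0:
  fixes F :: "'a::comm_ring_1 fps"
  assumes "F $ 0 = 0" "n < i"
  shows "(F ^ i * H) $ n = 0"
  using assms by (simp add: fps_mult_nth startsby_zero_power_prefix)

text \<open>\<open>F ^ i * H\<close> has order at least \<open>i\<close>, so a single bound
  \<open>M\<close> truncates the composition for all coefficients up to \<open>M\<close>.\<close>

lemma fps_compose_mult_nth:
  fixes F :: "'a::comm_ring_1 fps"
  assumes "F $ 0 = 0" "n \<le> M"
  shows "((a oo F) * H) $ n = (\<Sum>i\<le>M. a $ i * (F ^ i * H) $ n)"
proof -
  have "((a oo F) * H) $ n = (\<Sum>j=0..n. (\<Sum>i=0..j. a $ i * (F ^ i) $ j) * H $ (n - j))"
    by (simp add: fps_mult_nth fps_compose_nth)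
  also have "\<dots> = (\<Sum>j=0..n. (\<Sum>i\<le>M. a $ i * (F ^ i) $ j) * H $ (n - j))"
  proof (rule sum.cong[OF refl])
    fix j assume "j \<in> {0..n}"
    then have "(\<Sum>i=0..j. a $ i * (F ^ i) $ j) = (\<Sum>i\<le>M. a $ i * (F ^ i) $ j)"
      using assms by (intro sum.mono_neutral_left) (auto simp: startsby_zero_power_prefix)
    then show "(\<Sum>i=0..j. a $ i * (F ^ i) $ j) * H $ (n - j) = (\<Sum>i\<le>M. a $ i * (F ^ i) $ j) * H $ (n - j)"
      by (rule arg_cong)
  qed
  also have "\<dots> = (\<Sum>i\<le>M. a $ i * (F ^ i * H) $ n)"
    by (simp add: fps_mult_nth sum_distrib_left sum_distrib_right mult.assoc) (rule sum.swap)
  finally show ?thesis .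
qed

text \<open>With \<open>F = X / \<phi>\<close> and \<open>A\<close> its compositional inverse,
  differentiating \<open>A(F) = X\<close> gives \<open>A'(F) F' = 1\<close>. Multiplying by
  \<open>\<phi>^(N+1)\<close> and expanding \<open>A'(F)\<close> in powers of \<open>F\<close>, only
  the power \<open>F^N\<close> contributes to the coefficient at \<open>N\<close>.\<close>

lemma fps_lagrange_inversion:
  fixes \<phi> :: "'a::field_char_0 fps"
  assumes \<phi>: "\<phi> $ 0 \<noteq> 0"
  shows "of_nat (Suc N) * fps_inv (fps_X * inverse \<phi>) $ Suc N = (\<phi> ^ Suc N) $ N"
proof -
  define F where "F = fps_X * inverse \<phi>"
  define A where "A = fps_inv F"
  have F: "F $ 0 = 0" "F $ 1 \<noteq> 0" using \<phi> by (simp_all add: F_def)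
  have F\<phi>: "F * \<phi> = fps_X" using \<phi> by (simp add: F_def mult.assoc inverse_mult_eq_1)
  have "fps_deriv (F * \<phi>) = 1" by (simp add: F\<phi>)
  then have dF: "fps_deriv F * \<phi> = 1 - F * fps_deriv \<phi>" by (simp add: algebra_simps)
  have "fps_deriv F * \<phi> * \<phi> = \<phi> - (F * \<phi>) * fps_deriv \<phi>" unfolding dF by (simp add: algebra_simps)
  then have dF2: "fps_deriv F * \<phi> * \<phi> = \<phi> - fps_X * fps_deriv \<phi>" by (simp add: F\<phi>)
  have "fps_deriv (A oo F) = 1" unfolding A_def by (simp add: fps_inv[OF F])
  then have "(fps_deriv A oo F) * fps_deriv F = 1" by (simp add: fps_compose_deriv[OF F(1)])
  then have eq: "\<phi> ^ Suc N = (fps_deriv A oo F) * (fps_deriv F * \<phi> ^ Suc N)"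
    by (simp only: mult.assoc[symmetric]) simp
  have "(\<phi> ^ Suc N) $ N = ((fps_deriv A oo F) * (fps_deriv F * \<phi> ^ Suc N)) $ N"
    by (rule arg_cong[OF eq])
  also have "\<dots> = (\<Sum>i\<le>N. fps_deriv A $ i * (F ^ i * (fps_deriv F * \<phi> ^ Suc N)) $ N)"
    by (rule fps_compose_mult_nth[OF F(1) order_refl])
  also have "\<dots> = (\<Sum>i\<le>N. if i = N then fps_deriv A $ i else 0)"
  proof (intro sum.cong refl)
    fix i assume "i \<in> {..N}"
    then obtain j where N: "N = i + j" using le_Suc_ex by auto
    \<comment> \<open>Each factor \<open>F\<close> absorbs one \<open>\<phi>\<close> to become
      \<open>X\<close>, leaving the coefficient at \<open>j = N - i\<close> of
      \<open>F' \<phi>^(j+1)\<close>.\<close>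
    have "F ^ i * (fps_deriv F * \<phi> ^ Suc N) = (F * \<phi>) ^ i * (fps_deriv F * \<phi> ^ Suc j)"
      by (simp add: N power_mult_distrib power_add mult_ac)
    also have "\<dots> $ N = (fps_deriv F * \<phi> ^ Suc j) $ j"
      unfolding F\<phi> by (simp add: fps_X_power_mult_nth N)
    also have "\<dots> = (if j = 0 then 1 else 0)"
    proof (cases j)
      case 0
      then show ?thesis using F(1) by (simp add: dF)
    next
      case (Suc p)
      have "fps_deriv F * \<phi> ^ Suc j = fps_deriv F * \<phi> * \<phi> * \<phi> ^ p"
        by (simp add: Suc mult_ac)
      also have "\<dots> = \<phi> ^ j - fps_X * (fps_deriv \<phi> * \<phi> ^ p)"
        unfolding dF2 by (simp add: Suc algebra_simps)
      also have "\<dots> $ j = (\<phi> ^ j) $ j - (fps_deriv \<phi> * \<phi> ^ p) $ p"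
        by (simp add: Suc)
      \<comment> \<open>The factor \<open>j\<close> turns the subtracted term into a coefficient of
        the derivative of \<open>\<phi>^j\<close>; characteristic 0 later allows cancelling
        it.\<close>
      also have "of_nat j * \<dots> = 0"
      proof -
        have "of_nat j * (\<phi> ^ j) $ j = fps_deriv (\<phi> ^ j) $ p"
          by (simp only: fps_deriv_nth Suc Suc_eq_plus1)
        also have "\<dots> = of_nat j * (fps_deriv \<phi> * \<phi> ^ p) $ p"
          unfolding fps_deriv_power by (simp add: Suc mult.assoc del: of_nat_Suc)
        finally show ?thesis by (simp only: right_diff_distrib) simp
      qed
      finally have "of_nat j * (fps_deriv F * \<phi> ^ Suc j) $ j = 0" .
      moreover have "(of_nat j :: 'a) \<noteq> 0" using Suc by (simp del: of_nat_Suc)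
      ultimately show ?thesis using Suc by (simp only: mult_eq_0_iff) simp
    qed
    finally show "fps_deriv A $ i * (F ^ i * (fps_deriv F * \<phi> ^ Suc N)) $ N = (if i = N then fps_deriv A $ i else 0)"
      using N by auto
  qed
  also have "\<dots> = of_nat (Suc N) * A $ Suc N" by (simp del: of_nat_Suc)
  finally show ?thesis by (simp add: A_def F_def)
qed

section \<open>Kernel method for the walk series\<close>

text \<open>The series \<open>W(u)\<close> of step weights, with \<open>fps_X\<close> in the role of
  \<open>u\<close>.\<close>

definition run_fps :: "nat \<Rightarrow> 'a::comm_ring_1 \<Rightarrow> 'a fps" where
  "run_fps m x = Abs_fps (\<lambda>k. if m \<le> k then x else 1)"

lemma one_minus_X_mult_run_fps:
  assumes "m \<ge> 1"
  shows "(1 - fps_X) * run_fps m x = 1 + fps_const (x - 1) * fps_X ^ m"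
proof (rule fps_ext)
  fix n
  show "((1 - fps_X) * run_fps m x) $ n = (1 + fps_const (x - 1) * fps_X ^ m) $ n"
    using assms by (cases n) (auto simp: run_fps_def left_diff_distrib fps_X_power_nth)
qed

text \<open>The kernel substitution \<open>u = A\<close>, done on truncations: \<open>D M\<close> is
  \<open>\<Lambda>(A)\<close> cut at \<open>h <= M\<close>, and \<open>P M\<close> is
  \<open>W(A) \<Lambda>(A)\<close> cut at total exponent \<open>M\<close>. Multiplying the
  recurrence for \<open>L h\<close> by \<open>A^(h+1)\<close> and summing gives
  \<open>A D = A + X (P - L 0)\<close>, while \<open>A = X W(A)\<close> makes \<open>A D\<close> and
  \<open>X P\<close> agree at the coefficient considered.\<close>

lemma run_weight_gf_eq:
  fixes x :: "'a::comm_ring_1"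
  assumes m: "m \<ge> 1" and A0: "A $ 0 = 0" and A: "A = fps_X * (run_fps m x oo A)"
  shows "A = fps_X * Abs_fps (\<lambda>r. run_weight m x r 0)"
proof (rule fps_ext)
  fix n
  define w where "w = (\<lambda>k. if m \<le> k then x else 1)"
  define L where "L = (\<lambda>h. Abs_fps (\<lambda>r. run_weight m x r h))"
  define b where "b = (\<lambda>k. fps_const (w k) * A ^ k)"
  define c where "c = (\<lambda>h. L h * A ^ h)"
  define D where "D = (\<lambda>M. \<Sum>h\<le>M. c h)"
  define P where "P = (\<lambda>M. \<Sum>g\<le>M. \<Sum>k\<le>g. b k * c (g - k))"
  have L_rec: "L h = fps_const (of_bool (h = 0)) + fps_X * (\<Sum>k\<le>Suc h. fps_const (w k) * L (Suc h - k))" for h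
  proof (rule fps_ext)
    fix r
    show "L h $ r = (fps_const (of_bool (h = 0)) + fps_X * (\<Sum>k\<le>Suc h. fps_const (w k) * L (Suc h - k))) $ r"
      by (cases r) (simp_all add: L_def w_def fps_sum_nth del: sum.atMost_Suc)
  qed
  have P: "P M $ i = ((run_fps m x oo A) * D M) $ i" if "i \<le> M" for M i
  proof -
    have "((run_fps m x oo A) * D M) $ i = (\<Sum>k\<le>M. w k * (A ^ k * D M) $ i)"
      using fps_compose_mult_nth[OF A0 that, of "run_fps m x" "D M"] by (simp add: run_fps_def w_def)
    also have "\<dots> = (\<Sum>k\<le>M. \<Sum>h\<le>M. (b k * c h) $ i)"
      by (simp add: D_def b_def sum_distrib_left fps_sum_nth mult.assoc)
    also have "\<dots> = (\<Sum>(k, h)\<in>{..M} \<times> {..M}. (b k * c h) $ i)"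
      by (rule sum.cartesian_product)
    also have "\<dots> = (\<Sum>(k, h)\<in>{(k, h). k + h \<le> M}. (b k * c h) $ i)"
    proof (rule sum.mono_neutral_right)
      \<comment> \<open>The discarded products are divisible by \<open>A^(M+1)\<close>, whose order
        exceeds \<open>i\<close>.\<close>
      have "(b k * c h) $ i = 0" if "\<not> k + h \<le> M" for k h
      proof -
        have "b k * c h = A ^ (k + h) * (fps_const (w k) * L h)"
          by (simp add: b_def c_def power_add mult_ac)
        then show ?thesis using that \<open>i \<le> M\<close> fps_nth_power_mult_eq_0[OF A0] by simp
      qed
      then show "\<forall>z\<in>{..M} \<times> {..M} - {(k, h). k + h \<le> M}. (case z of (k, h) \<Rightarrow> (b k * c h) $ i) = 0"
        by auto
    qed auto
    also have "\<dots> = (\<Sum>g\<le>M. \<Sum>k\<le>g. (b k * c (g - k)) $ i)"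
      by (rule sum.triangle_reindex_eq)
    finally show ?thesis by (simp add: P_def fps_sum_nth)
  qed
  have "A * D n = (\<Sum>h\<le>n. A * c h)" by (simp add: D_def sum_distrib_left)
  also have "\<dots> = (\<Sum>h\<le>n. fps_const (of_bool (h = 0)) * A + fps_X * (\<Sum>k\<le>Suc h. b k * c (Suc h - k)))"
  proof (intro sum.cong refl)
    fix h
    have "A * c h = L h * A ^ Suc h" by (simp add: c_def mult_ac)
    also have "\<dots> = fps_const (of_bool (h = 0)) * A ^ Suc h + fps_X * (\<Sum>k\<le>Suc h. fps_const (w k) * L (Suc h - k) * A ^ Suc h)"
      by (subst L_rec) (simp only: distrib_right sum_distrib_right mult.assoc)
    also have "(\<Sum>k\<le>Suc h. fps_const (w k) * L (Suc h - k) * A ^ Suc h) = (\<Sum>k\<le>Suc h. b k * c (Suc h - k))"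
    proof (intro sum.cong refl)
      fix k assume "k \<in> {..Suc h}"
      then have "A ^ Suc h = A ^ k * A ^ (Suc h - k)" by (simp flip: power_add del: power_Suc)
      then show "fps_const (w k) * L (Suc h - k) * A ^ Suc h = b k * c (Suc h - k)"
        by (simp only: b_def c_def mult_ac)
    qed
    also have "fps_const (of_bool (h = 0)) * A ^ Suc h = fps_const (of_bool (h = 0)) * A" by simp
    finally show "A * c h = fps_const (of_bool (h = 0)) * A + fps_X * (\<Sum>k\<le>Suc h. b k * c (Suc h - k))" .
  qed
  also have "\<dots> = (\<Sum>h\<le>n. fps_const (of_bool (h = 0)) * A) + fps_X * (\<Sum>h\<le>n. \<Sum>k\<le>Suc h. b k * c (Suc h - k))"
    by (simp only: sum.distrib sum_distrib_left)
  also have "(\<Sum>h\<le>n. fps_const (of_bool (h = 0)) * A) = A"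
  proof -
    have "(\<Sum>h\<le>n. fps_const (of_bool (h = 0)) * A) = (\<Sum>h\<le>n. if h = 0 then A else 0)"
      by (intro sum.cong) auto
    then show ?thesis by simp
  qed
  also have "(\<Sum>h\<le>n. \<Sum>k\<le>Suc h. b k * c (Suc h - k)) = P (Suc n) - L 0"
  proof -
    \<comment> \<open>The recurrence yields only the levels \<open>g = h + 1\<close>; the missing
      level \<open>g = 0\<close> is \<open>L 0\<close>, because \<open>w 0 = 1\<close>.\<close>
    have "P (Suc n) = b 0 * c 0 + (\<Sum>h\<le>n. \<Sum>k\<le>Suc h. b k * c (Suc h - k))"
      unfolding P_def by (subst sum.atMost_Suc_shift) simp
    moreover have "b 0 * c 0 = L 0" using m by (simp add: b_def c_def w_def)
    ultimately show ?thesis by simp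
  qed
  finally have main: "A * D n = A + fps_X * (P (Suc n) - L 0)" .
  have "(A * D (Suc n)) $ n = (fps_X * ((run_fps m x oo A) * D (Suc n))) $ n"
    by (subst A) (simp only: mult.assoc)
  also have "\<dots> = (fps_X * P (Suc n)) $ n" by (cases n) (simp_all add: P)
  finally have 1: "(fps_X * P (Suc n)) $ n = (A * D (Suc n)) $ n" ..
  \<comment> \<open>\<open>P (Suc n)\<close> belongs to \<open>D (Suc n)\<close> but occurs with
    \<open>D n\<close>; the difference has order at least \<open>n + 2\<close>.\<close>
  have "A * D (Suc n) = A * D n + A ^ Suc (Suc n) * L (Suc n)"
    by (simp add: D_def c_def algebra_simps)
  moreover have "(A ^ Suc (Suc n) * L (Suc n)) $ n = 0"
    by (rule fps_nth_power_mult_eq_0[OF A0]) simp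
  ultimately have 2: "(A * D (Suc n)) $ n = (A * D n) $ n" by simp
  have "A $ n = (A * D n - fps_X * P (Suc n) + fps_X * L 0) $ n"
    by (simp add: main algebra_simps)
  also have "\<dots> = (fps_X * L 0) $ n" using 1 2 by simp
  finally show "A $ n = (fps_X * Abs_fps (\<lambda>r. run_weight m x r 0)) $ n"
    by (simp add: L_def)
qed

text \<open>The compositional inverse \<open>A\<close> of \<open>X / W\<close> solves
  \<open>A = X W(A)\<close>, so \<open>A = X G\<close> and \<open>W(A) = G\<close>. Substituting
  \<open>A\<close> into the rational form of \<open>W\<close> gives the functional equation,
  Lagrange inversion the coefficients.\<close>

lemma run_weight_gf:
  fixes x :: "'a::field_char_0" and m :: nat
  assumes m: "m \<ge> 1"
  defines "G \<equiv> Abs_fps (\<lambda>r. run_weight m x r 0)"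
  shows "G * (1 - fps_X * G) = 1 + fps_const (x - 1) * fps_X ^ m * G ^ m"
    and "of_nat (Suc n) * G $ n = (run_fps m x ^ Suc n) $ n"
proof -
  let ?\<phi> = "run_fps m x"
  define A where "A = fps_inv (fps_X * inverse ?\<phi>)"
  have \<phi>: "?\<phi> $ 0 \<noteq> 0" using m by (simp add: run_fps_def)
  have A0: "A $ 0 = 0" by (simp add: A_def fps_inv_def)
  have "fps_X * inverse ?\<phi> oo A = fps_X"
    unfolding A_def by (rule fps_inv_right) (use \<phi> in simp_all)
  then have "A * (inverse ?\<phi> oo A) = fps_X" by (simp add: fps_compose_mult_distrib A0)
  then have "A * inverse (?\<phi> oo A) = fps_X" by (simp add: fps_inverse_compose[OF A0 \<phi>])
  then have "A * (inverse (?\<phi> oo A) * (?\<phi> oo A)) = fps_X * (?\<phi> oo A)"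
    by (metis mult.assoc)
  then have A: "A = fps_X * (?\<phi> oo A)" using \<phi> by (simp add: inverse_mult_eq_1)
  have AG: "A = fps_X * G"
    unfolding G_def by (rule run_weight_gf_eq[OF m A0 A])
  then have G: "?\<phi> oo A = G" using A by simp
  have "(1 - fps_X) * ?\<phi> oo A = 1 + fps_const (x - 1) * fps_X ^ m oo A"
    by (simp only: one_minus_X_mult_run_fps[OF m])
  then have "(1 - A) * G = 1 + fps_const (x - 1) * A ^ m"
    by (simp add: fps_compose_mult_distrib[OF A0] fps_compose_add_distrib fps_compose_sub_distrib
      fps_compose_power[OF A0, symmetric] G A0)
  then show "G * (1 - fps_X * G) = 1 + fps_const (x - 1) * fps_X ^ m * G ^ m"
    unfolding AG by (simp add: power_mult_distrib mult_ac)
  have "A $ Suc n = G $ n" unfolding AG by simp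
  then show "of_nat (Suc n) * G $ n = (?\<phi> ^ Suc n) $ n"
    using fps_lagrange_inversion[OF \<phi>, of n] by (simp only: A_def)
qed

text \<open>Binomial theorem for the numerator and negative binomial series for the denominator of
  \<open>W^(n+1)\<close>; terms with \<open>m * i > n\<close> vanish.\<close>

lemma run_fps_power_nth:
  fixes x :: "'a::field_char_0"
  assumes m: "m \<ge> 1"
  shows "(run_fps m x ^ Suc n) $ n =
    (\<Sum>i\<le>n div m. of_nat ((Suc n choose i) * ((2 * n - m * i) choose n)) * (x - 1) ^ i)"
proof -
  let ?C = "1 + fps_const (x - 1) * fps_X ^ m"
  have "inverse ((1 - fps_X) :: 'a fps) * (1 - fps_X) = 1" by (rule inverse_mult_eq_1) simp
  then have "run_fps m x = ?C * inverse (1 - fps_X)"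
    unfolding one_minus_X_mult_run_fps[OF m, symmetric] by (metis mult.commute mult.assoc mult_1)
  then have "run_fps m x ^ Suc n = ?C ^ Suc n * inverse ((1 - fps_X) ^ Suc n)"
    by (simp only: power_mult_distrib fps_inverse_power)
  also have "inverse ((1 - fps_X) ^ Suc n) = Abs_fps (\<lambda>k. of_nat ((n + k) choose k) :: 'a)"
    using one_minus_const_fps_X_neg_power'[of "Suc n" "1 :: 'a"] by simp
  also have "?C ^ Suc n = (\<Sum>i\<le>Suc n. of_nat (Suc n choose i) * (fps_const (x - 1) * fps_X ^ m) ^ i)"
    by (subst add.commute, subst binomial_ring) (simp only: power_one mult_1_right)
  also have "\<dots> = (\<Sum>i\<le>Suc n. fps_const (of_nat (Suc n choose i) * (x - 1) ^ i) * fps_X ^ (m * i))"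
    by (intro sum.cong refl) (simp only: power_mult_distrib fps_const_power power_mult
      fps_of_nat[symmetric] fps_const_mult[symmetric] mult.assoc)
  finally have "(run_fps m x ^ Suc n) $ n =
    ((\<Sum>i\<le>Suc n. fps_const (of_nat (Suc n choose i) * (x - 1) ^ i) * fps_X ^ (m * i)) *
      Abs_fps (\<lambda>k. of_nat ((n + k) choose k))) $ n"
    by (rule arg_cong)
  also have "\<dots> =
    (\<Sum>i\<le>Suc n. of_nat (Suc n choose i) * (x - 1) ^ i * (if n < m * i then 0 else of_nat ((n + (n - m * i)) choose (n - m * i))))"
    by (simp only: sum_distrib_right fps_sum_nth mult.assoc fps_mult_left_const_nth fps_X_power_mult_nth fps_nth_Abs_fps)
  also have "\<dots> = (\<Sum>i\<le>n div m. of_nat ((Suc n choose i) * ((2 * n - m * i) choose n)) * (x - 1) ^ i)"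
  proof (rule sum.mono_neutral_cong_right)
    show "{..n div m} \<subseteq> {..Suc n}" using le_SucI[OF div_le_dividend[of n m]] by simp
    have "n < m * i" if "i \<notin> {..n div m}" for i
      using that m by (simp add: not_le div_less_iff_less_mult mult.commute)
    then show "\<forall>i\<in>{..Suc n} - {..n div m}. of_nat (Suc n choose i) * (x - 1) ^ i * (if n < m * i then 0 else of_nat ((n + (n - m * i)) choose (n - m * i))) = 0"
      by (simp del: binomial_Suc_Suc atMost_iff)
  next
    fix i assume "i \<in> {..n div m}"
    then have "m * i \<le> n" using m by (metis atMost_iff div_times_less_eq_dividend le_trans mult.commute mult_le_mono2)
    then have "2 * n - m * i = n + (n - m * i)" by simp
    then have "((n + (n - m * i)) choose (n - m * i)) = ((2 * n - m * i) choose n)"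
      using binomial_symmetric[of n "n + (n - m * i)"] by simp
    then show "of_nat (Suc n choose i) * (x - 1) ^ i * (if n < m * i then 0 else of_nat ((n + (n - m * i)) choose (n - m * i))) =
      of_nat ((Suc n choose i) * ((2 * n - m * i) choose n)) * (x - 1) ^ i"
      using \<open>m * i \<le> n\<close> by (simp del: binomial_Suc_Suc)
  qed simp
  finally show ?thesis .
qed

section \<open>Specialisation of \<open>x\<close> to a number\<close>

lemma poly_run_weight: "poly (run_weight m p r h) q = run_weight m (poly p q) r h"
proof (induction r arbitrary: h)
  case (Suc r)
  have "poly (if m \<le> k then p else 1) q = (if m \<le> k then poly p q else 1)" for k by simp
  then show ?case by (simp only: run_weight.simps poly_sum poly_mult Suc.IH)
qed simp

definition eval_coeffs :: "'a::comm_ring_1 \<Rightarrow> 'a poly fps \<Rightarrow> 'a fps" where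
  "eval_coeffs q F = Abs_fps (\<lambda>n. poly (F $ n) q)"

lemma eval_coeffs_nth: "eval_coeffs q F $ n = poly (F $ n) q"
  by (simp add: eval_coeffs_def)

lemma eval_coeffs_mult: "eval_coeffs q (F * G) = eval_coeffs q F * eval_coeffs q G"
  by (rule fps_ext) (simp add: eval_coeffs_nth fps_mult_nth poly_sum)

lemma eval_coeffs_simps:
  "eval_coeffs q (F + G) = eval_coeffs q F + eval_coeffs q G"
  "eval_coeffs q (F - G) = eval_coeffs q F - eval_coeffs q G"
  "eval_coeffs q 1 = 1"
  "eval_coeffs q fps_X = fps_X"
  "eval_coeffs q (fps_const p) = fps_const (poly p q)"
  by (rule fps_ext, simp add: eval_coeffs_nth)+

lemma eval_coeffs_power: "eval_coeffs q (F ^ n) = eval_coeffs q F ^ n"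
  by (induction n) (simp_all add: eval_coeffs_simps eval_coeffs_mult)

text \<open>A polynomial over an infinite field is determined by its values, so identities proved
  for every specialisation lift back.\<close>

lemma eval_coeffs_eqI:
  fixes F G :: "'a::field_char_0 poly fps"
  assumes "\<And>q. eval_coeffs q F = eval_coeffs q G"
  shows "F = G"
proof (rule fps_ext)
  fix n
  have "poly (F $ n) q = poly (G $ n) q" for q
    using arg_cong[OF assms[of q], of "\<lambda>H. H $ n"] by (simp add: eval_coeffs_nth)
  then show "F $ n = G $ n" by (simp add: poly_eq_poly_eq_iff[symmetric] fun_eq_iff)
qed

text \<open>Links the multinomial to the binomials from Lagrange inversion and from expanding
  \<open>(x - 1)^i\<close>; the bounds make the subtractions on naturals exact.\<close>

lemma multinom_eq:
  assumes "1 \<le> k" "k \<le> i" "i \<le> Suc n" "m * i \<le> n"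
  shows "multinom (2 * n - m * i) [n - m * i, n + 1 - i, k - 1, i - k] =
    of_nat k * of_nat ((Suc n choose i) * ((2 * n - m * i) choose n) * (i choose k)) / of_nat (Suc n)"
proof -
  obtain l where k: "k = Suc l" using assms(1) by (cases k) auto
  have "2 * n - m * i - n = n - m * i" using assms(4) by simp
  then have 1: "of_nat ((2 * n - m * i) choose n) = (fact (2 * n - m * i) / (fact n * fact (n - m * i)) :: rat)"
    using assms(4) by (subst binomial_fact) simp_all
  have 2: "of_nat (Suc n choose i) = (fact (Suc n) / (fact i * fact (n + 1 - i)) :: rat)"
    using assms(3) by (subst binomial_fact) simp_all
  have 3: "of_nat (i choose k) = (fact i / (fact k * fact (i - k)) :: rat)"
    using assms(2) by (rule binomial_fact)
  have 4: "(fact (Suc n) :: rat) = of_nat (Suc n) * fact n" "(fact k :: rat) = of_nat k * fact (k - 1)"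
    by (simp_all only: fact_Suc k diff_Suc_1)
  have "(of_nat (Suc n) :: rat) \<noteq> 0" "(of_nat k :: rat) \<noteq> 0" using k by (simp_all del: of_nat_Suc)
  then show ?thesis
    unfolding of_nat_mult 1 2 3 4 multinom_def by (simp add: field_simps del: of_nat_Suc)
qed

theorem theorem9:
  fixes m :: nat and B :: "rat poly fps"
  assumes "m \<ge> 2"
    and "B = match_gf [1, 2, 3] (gamma_pat m)"
  shows "B = (1 + fps_const ([:0, 1:] - 1) * fps_X ^ m * B ^ m)
               * fps_right_inverse (1 - fps_X * B) 1
       \<and> (\<forall>n k :: nat. k \<ge> 1 \<longrightarrow>
            poly.coeff (fps_nth B n) k =
              1 / of_nat k * (\<Sum>i = k..n div m. (-1) ^ (i - k) *
                multinom (2 * n - m * i) [n - m * i, n + 1 - i, k - 1, i - k]))"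
proof (intro conjI allI impI)
  have m: "m \<ge> 1" using assms(1) by simp
  have ev: "eval_coeffs q B = Abs_fps (\<lambda>r. run_weight m q r 0)" for q
    using match_gf_nth[OF assms(1)] by (simp add: eval_coeffs_def assms(2) poly_run_weight)
  have "B * (1 - fps_X * B) = 1 + fps_const ([:0, 1:] - 1) * fps_X ^ m * B ^ m"
  proof (rule eval_coeffs_eqI)
    fix q
    show "eval_coeffs q (B * (1 - fps_X * B)) = eval_coeffs q (1 + fps_const ([:0, 1:] - 1) * fps_X ^ m * B ^ m)"
      using run_weight_gf(1)[OF m, of q] by (simp add: eval_coeffs_simps eval_coeffs_mult eval_coeffs_power ev del: fps_const_sub)
  qed
  \<comment> \<open>Inserting the inverse of \<open>1 - X B\<close> turns the product identity into
    the quotient form.\<close>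
  moreover have "B = B * ((1 - fps_X * B) * fps_right_inverse (1 - fps_X * B) 1)"
    by (simp only: fps_right_inverse_one_minus_X_mult mult_1_right)
  ultimately show "B = (1 + fps_const ([:0, 1:] - 1) * fps_X ^ m * B ^ m) * fps_right_inverse (1 - fps_X * B) 1"
    by (metis mult.assoc)
  fix n k :: nat
  assume k: "k \<ge> 1"
  \<comment> \<open>The coefficient of \<open>(x - 1)^i\<close> in \<open>B $ n\<close>, with the
    factor \<open>1 / (n + 1)\<close> of Lagrange inversion included.\<close>
  define a where "a = (\<lambda>i. of_nat ((Suc n choose i) * ((2 * n - m * i) choose n)) / of_nat (Suc n) :: rat)"
  have "poly (B $ n) q = poly (\<Sum>i\<le>n div m. smult (a i) ([:- 1, 1:] ^ i)) q" for q
  proof -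
    have "poly (B $ n) q = Abs_fps (\<lambda>r. run_weight m q r 0) $ n"
      by (simp flip: ev add: eval_coeffs_nth)
    also have "\<dots> = (run_fps m q ^ Suc n) $ n / of_nat (Suc n)"
      unfolding run_weight_gf(2)[OF m, symmetric] by (simp del: of_nat_Suc)
    also have "\<dots> = (\<Sum>i\<le>n div m. a i * (q - 1) ^ i)"
      unfolding run_fps_power_nth[OF m] sum_divide_distrib a_def by simp
    finally show ?thesis by (simp add: poly_sum)
  qed
  then have B: "B $ n = (\<Sum>i\<le>n div m. smult (a i) ([:- 1, 1:] ^ i))"
    by (simp add: poly_eq_poly_eq_iff[symmetric] fun_eq_iff)
  have "coeff (B $ n) k = (\<Sum>i\<le>n div m. a i * coeff ([:- 1, 1:] ^ i) k)"
    by (simp add: B coeff_sum)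
  also have "\<dots> = (\<Sum>i = k..n div m. a i * coeff ([:- 1, 1:] ^ i) k)"
  proof (rule sum.mono_neutral_right)
    have "coeff ([:- 1, 1 :: rat:] ^ i) k = 0" if "i < k" for i
      using that by (intro coeff_eq_0) (simp add: degree_linear_power)
    then show "\<forall>i\<in>{..n div m} - {k..n div m}. a i * coeff ([:- 1, 1:] ^ i) k = 0" by auto
  qed auto
  also have "\<dots> = (\<Sum>i = k..n div m. 1 / of_nat k * ((-1) ^ (i - k) *
      multinom (2 * n - m * i) [n - m * i, n + 1 - i, k - 1, i - k]))"
  proof (intro sum.cong refl)
    fix i assume i: "i \<in> {k..n div m}"
    then have "i \<le> Suc n" using div_le_dividend[of n m] by (meson atLeastAtMost_iff le_SucI le_trans)
    moreover have "m * i \<le> n"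
      using i m by (metis atLeastAtMost_iff div_times_less_eq_dividend le_trans mult.commute mult_le_mono2)
    ultimately have M: "1 / of_nat k * multinom (2 * n - m * i) [n - m * i, n + 1 - i, k - 1, i - k] =
        a i * of_nat (i choose k)"
      using multinom_eq[OF k, of i n m] i k by (simp add: a_def del: of_nat_Suc binomial_Suc_Suc)
    have "coeff ([:- 1, 1 :: rat:] ^ i) k = of_nat (i choose k) * (-1) ^ (i - k)"
      using coeff_linear_poly_power[of k i "-1 :: rat" 1] i by simp
    then have "a i * coeff ([:- 1, 1:] ^ i) k = (a i * of_nat (i choose k)) * (-1) ^ (i - k)"
      by (simp only: mult.assoc)
    then show "a i * coeff ([:- 1, 1:] ^ i) k = 1 / of_nat k * ((-1) ^ (i - k) *
      multinom (2 * n - m * i) [n - m * i, n + 1 - i, k - 1, i - k])"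
      unfolding M[symmetric] by (simp only: mult_ac)
  qed
  also have "\<dots> = 1 / of_nat k * (\<Sum>i = k..n div m. (-1) ^ (i - k) *
      multinom (2 * n - m * i) [n - m * i, n + 1 - i, k - 1, i - k])"
    by (simp only: sum_distrib_left)
  finally show "coeff (B $ n) k = 1 / of_nat k * (\<Sum>i = k..n div m. (-1) ^ (i - k) *
      multinom (2 * n - m * i) [n - m * i, n + 1 - i, k - 1, i - k])" .
qed

end
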